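(* A separable metric space $X$ has uniform dimension zero ($\dim_u(X)\le 0$) if and only if it admits a bi-uniform embedding into the space $(L_\omega,\mu)$.
   Context: Write $\mathbb{R}_+=[0,\infty)$. For $S>0$, an $S$-chain in a metric space $X$ is a finite sequence $x_1,\dots,x_k$ of points of $X$ with $d(x_i,x_{i+1})\le S$ for all $i<k$. A subset is $S$-connected if any two of its points can be joined by an $S$-chain inside the subset; the $S$-components of $X$ are its maximal $S$-connected subsets. A subset is $D$-bounded if any two of its points are at distance $\le D$. $\dim_u(X)\le 0$ means: there is a continuous increasing function $\mathcal{D}\colon\mathbb{R}_+\to\mathbb{R}_+$ with $\mathcal{D}(0)=0$ and $\lim_{t\to\infty}\mathcal{D}(t)=\infty$ such that for every $S>0$ every $S$-component of $X$ is $\mathcal{D}(S)$-bounded. (Here "increasing" and "continuous" guarantee that $\mathcal{D}$ has an inverse function.) A map $f\colon X\to Y$ of metric spaces is uniform if there is a function $\delta_f\colon\mathbb{R}_+\to\mathbb{R}_+$ with $\lim_{t\to0}\delta_f(t)=0$ such that $d_Y(f(x),f(x'))\le\delta_f(d_X(x,x'))$ for all $x,x'\in X$. A bi-uniform embedding is an injective map $f\colon X\to Y$ such that both $f$ and $f^{-1}\colon f(X)\to X$ are uniform. The space $(L_\omega,\mu)$: fix a countably infinite set $A$ with a distinguished element $s_0\in A$. $L_\omega$ is the set of all sequences $\bar x=\{x_n\}_{n\in\mathbb{Z}}$ with all $x_n\in A$ for which there is $k\in\mathbb{Z}$ with $x_n=s_0$ for all $n<k$. For $\bar x\neq\bar y$,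 $\mu(\bar x,\bar y)=3^{-m}$ where $m\in\mathbb{Z}$ is the minimal index with $x_m\ne y_m$ (and $\mu(\bar x,\bar x)=0$).
   Formalization: The function δ_f in the definition of a uniform map is required to be nondecreasing; with an arbitrary δ_f the claim fails, e.g. for the subspace {n + 3^(-n-1) : n ≥ 0} of the real line. *)

theory Defs
  imports "HOL-Analysis.Analysis"
begin

section \<open>Uniform dimension zero\<close>

definition S_chain :: "'a metric \<Rightarrow> real \<Rightarrow> 'a list \<Rightarrow> bool" where
  "S_chain X S xs \<longleftrightarrow>
     xs \<noteq> [] \<and> set xs \<subseteq> mspace X \<and> successively (\<lambda>x y. mdist X x y \<le> S) xs"

definition S_connected :: "'a metric \<Rightarrow> real \<Rightarrow> 'a set \<Rightarrow> bool" where
  "S_connected X S C \<longleftrightarrow> C \<subseteq> mspace X \<and>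
     (\<forall>x\<in>C. \<forall>y\<in>C. \<exists>xs. S_chain X S xs \<and> set xs \<subseteq> C \<and> hd xs = x \<and> last xs = y)"

definition S_component :: "'a metric \<Rightarrow> real \<Rightarrow> 'a set \<Rightarrow> bool" where
  "S_component X S C \<longleftrightarrow> S_connected X S C \<and> (\<forall>C'. S_connected X S C' \<and> C \<subseteq> C' \<longrightarrow> C' = C)"

definition D_bounded :: "'a metric \<Rightarrow> real \<Rightarrow> 'a set \<Rightarrow> bool" where
  "D_bounded X D C \<longleftrightarrow> C \<subseteq> mspace X \<and> (\<forall>x\<in>C. \<forall>y\<in>C. mdist X x y \<le> D)"

text \<open>``Increasing'' is strict: the control function is required to have an inverse.\<close>

definition dim_u_le_0 :: "'a metric \<Rightarrow> bool" where
  "dim_u_le_0 X \<longleftrightarrow>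
     (\<exists>D :: real \<Rightarrow> real. D ` {0..} \<subseteq> {0..} \<and> continuous_on {0..} D \<and> strict_mono_on {0..} D \<and>
        D 0 = 0 \<and> filterlim D at_top at_top \<and>
        (\<forall>S>0. \<forall>C. S_component X S C \<longrightarrow> D_bounded X (D S) C))"

section \<open>Uniform maps\<close>

text \<open>
  The modulus is real-valued on all of \<open>[0, \<infinity>)\<close> and controls the map at every scale, so this is
  stronger than uniform continuity.  As is customary for a modulus, it is nondecreasing.
  This matters at large scales: with a completely arbitrary function the condition would say
  nothing about spaces whose nonzero distances are bounded away from \<open>0\<close> and pairwise distinct.
  For instance, for \<open>x_n = n + 3 powi (-n - 1)\<close>, the space \<open>{x_n | n \<in> \<nat>} \<subseteq> \<real>\<close>, which does not have
  uniform dimension zero, would embed bi-uniformly into the space \<open>L_omega\<close> defined below, by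
  sending \<open>x_n\<close> to a sequence that differs from the constant one \<open>s0\<close> exactly at the index \<open>-n\<close>.
\<close>

definition uniform_map :: "'a metric \<Rightarrow> 'b metric \<Rightarrow> ('a \<Rightarrow> 'b) \<Rightarrow> bool" where
  "uniform_map X Y f \<longleftrightarrow> f ` mspace X \<subseteq> mspace Y \<and>
     (\<exists>\<delta> :: real \<Rightarrow> real. \<delta> ` {0..} \<subseteq> {0..} \<and> mono_on {0..} \<delta> \<and>
        (\<delta> \<longlongrightarrow> 0) (at 0 within {0..}) \<and>
        (\<forall>x\<in>mspace X. \<forall>x'\<in>mspace X. mdist Y (f x) (f x') \<le> \<delta> (mdist X x x')))"

definition bi_uniform_embedding :: "'a metric \<Rightarrow> 'b metric \<Rightarrow> ('a \<Rightarrow> 'b) \<Rightarrow> bool" where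
  "bi_uniform_embedding X Y f \<longleftrightarrow> inj_on f (mspace X) \<and> uniform_map X Y f \<and>
     uniform_map (submetric Y (f ` mspace X)) X (inv_into (mspace X) f)"

section \<open>The space of sequences\<close>

definition L_omega_set :: "'b set \<Rightarrow> 'b \<Rightarrow> (int \<Rightarrow> 'b) set" where
  "L_omega_set A s0 = {x. (\<forall>n. x n \<in> A) \<and> (\<exists>k. \<forall>n<k. x n = s0)}"

text \<open>For distinct elements of \<open>L_omega_set A s0\<close> the set of indices where they differ is bounded
  below, so the \<open>LEAST\<close> index exists.\<close>

definition mu :: "(int \<Rightarrow> 'b) \<Rightarrow> (int \<Rightarrow> 'b) \<Rightarrow> real" where
  "mu x y = (if x = y then 0 else 3 powi (- (LEAST m. x m \<noteq> y m)))"

definition L_omega :: "'b set \<Rightarrow> 'b \<Rightarrow> (int \<Rightarrow> 'b) metric" where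
  "L_omega A s0 = metric (L_omega_set A s0, mu)"

lemma int_least_bounded_below:
  fixes P :: "int \<Rightarrow> bool"
  assumes "P i" and "\<And>n. n < k \<Longrightarrow> \<not> P n"
  shows "P (LEAST m. P m) \<and> (\<forall>n. P n \<longrightarrow> (LEAST m. P m) \<le> n)"
proof -
  define j where "j = (LEAST j. P (k + int j))"
  have ki: "P (k + int (nat (i - k)))"
    using assms by (smt (verit) int_nat_eq)
  have Pj: "P (k + int j)"
    unfolding j_def by (rule LeastI) (rule ki)
  have min: "k + int j \<le> n" if "P n" for n
  proof -
    have "k \<le> n" using assms(2) that by (meson not_le)
    then have "P (k + int (nat (n - k)))" using that by simp
    then have "j \<le> nat (n - k)" unfolding j_def by (rule Least_le)
    then show ?thesis using \<open>k \<le> n\<close> by linarith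
  qed
  have "(LEAST m. P m) = k + int j"
    by (rule Least_equality) (use Pj min in auto)
  then show ?thesis using Pj min by simp
qed

lemma mu_index:
  assumes "x \<in> L_omega_set A s0" "y \<in> L_omega_set A s0" "x \<noteq> y"
  shows "\<exists>m. x m \<noteq> y m \<and> (\<forall>n<m. x n = y n) \<and> mu x y = 3 powi (- m)"
proof -
  obtain k l where "\<forall>n<k. x n = s0" "\<forall>n<l. y n = s0"
    using assms unfolding L_omega_set_def by blast
  then have "\<And>n. n < min k l \<Longrightarrow> \<not> x n \<noteq> y n" by simp
  moreover obtain i where "x i \<noteq> y i" using assms(3) by blast
  ultimately have L: "x (LEAST m. x m \<noteq> y m) \<noteq> y (LEAST m. x m \<noteq> y m)"
      "\<forall>n. x n \<noteq> y n \<longrightarrow> (LEAST m. x m \<noteq> y m) \<le> n"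
    using int_least_bounded_below[of "\<lambda>m. x m \<noteq> y m" i "min k l"] by blast+
  then have "\<forall>n<(LEAST m. x m \<noteq> y m). x n = y n" by (meson not_le)
  with L assms(3) show ?thesis by (auto simp: mu_def)
qed

lemma mu_nonneg: "0 \<le> mu x y"
  by (simp add: mu_def)

lemma mu_ultrametric:
  assumes "x \<in> L_omega_set A s0" "y \<in> L_omega_set A s0" "z \<in> L_omega_set A s0"
  shows "mu x z \<le> max (mu x y) (mu y z)"
proof (cases "x = y \<or> y = z \<or> x = z")
  case True
  then show ?thesis
    using mu_nonneg[of x y] mu_nonneg[of y z] by (auto simp: mu_def[of x x] mu_def[of z z] le_max_iff_disj)
next
  case False
  obtain a where a: "\<forall>n<a. x n = y n" "mu x y = 3 powi (- a)"
    using mu_index[OF assms(1,2)] False by blast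
  obtain b where b: "\<forall>n<b. y n = z n" "mu y z = 3 powi (- b)"
    using mu_index[OF assms(2,3)] False by blast
  obtain c where c: "x c \<noteq> z c" "mu x z = 3 powi (- c)"
    using mu_index[OF assms(1,3)] False by blast
  have "a \<le> c \<or> b \<le> c" using a(1) b(1) c(1) by (metis not_le)
  then have "- c \<le> - a \<or> - c \<le> - b" by simp
  then show ?thesis
    unfolding a(2) b(2) c(2) le_max_iff_disj
    by (meson one_le_numeral power_int_increasing)
qed

lemma Metric_space_L_omega: "Metric_space (L_omega_set A s0) mu"
proof
  show "mu x y = mu y x" for x y :: "int \<Rightarrow> 'a"
    unfolding mu_def by (simp add: eq_commute)
  show "mu x y = 0 \<longleftrightarrow> x = y" for x y :: "int \<Rightarrow> 'a"
    by (simp add: mu_def)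
  show "mu x z \<le> mu x y + mu y z"
    if "x \<in> L_omega_set A s0" "y \<in> L_omega_set A s0" "z \<in> L_omega_set A s0" for x y z
    using mu_ultrametric[OF that] mu_nonneg[of x y] mu_nonneg[of y z] by linarith
qed (rule mu_nonneg)

lemma mspace_L_omega [simp]: "mspace (L_omega A s0) = L_omega_set A s0"
  unfolding L_omega_def by (rule Metric_space.mspace_metric[OF Metric_space_L_omega])

lemma mdist_L_omega [simp]: "mdist (L_omega A s0) = mu"
  unfolding L_omega_def by (rule Metric_space.mdist_metric[OF Metric_space_L_omega])

end

theory Submission
  imports Defs
begin

text \<open>
  A space of uniform dimension zero is embedded by letting the entry of the image sequence at
  index \<open>m\<close> encode the \<open>3\<^sup>-\<^sup>m\<close>-component of the point.  By separability there are
  only countably many components at each scale, so they can be coded injectively by elements of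
  \<open>A\<close>, the component of a base point receiving \<open>s0\<close>; since every point lies in the component of the
  base point at large scales, the sequence is \<open>s0\<close> far to the left.  Components are
  nested, so two sequences first differ at the index at which the components separate; the map is
  therefore 1-Lipschitz and its inverse has modulus \<open>t \<mapsto> D (3 t)\<close>.

  Conversely \<open>mu\<close> is an ultrametric, so the image of an \<open>S\<close>-component has diameter at most
  \<open>\<delta> S\<close>, and the component itself has diameter at most \<open>g S = \<epsilon> (\<delta> S)\<close>, where \<open>\<epsilon>\<close> is the modulus
  of the inverse.  Averaging the monotone function \<open>g\<close> over \<open>[S, 2 S]\<close> and adding \<open>S\<close> produces a
  continuous strictly increasing majorant.
\<close>

section \<open>Chain components\<close>

text \<open>For \<open>S \<ge> 0\<close> this is an equivalence relation on the space, and its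
  classes are \<open>S\<close>-components. Working with a relation between points avoids arguing
  with maximal connected sets.\<close>

definition reachable :: "'a metric \<Rightarrow> real \<Rightarrow> 'a \<Rightarrow> 'a \<Rightarrow> bool" where
  "reachable X S x y \<longleftrightarrow> (\<exists>xs. S_chain X S xs \<and> hd xs = x \<and> last xs = y)"

lemma reachable_mspace:
  assumes "reachable X S x y"
  shows "x \<in> mspace X" "y \<in> mspace X"
  using assms hd_in_set last_in_set unfolding reachable_def S_chain_def by auto

lemma reachable_step:
  assumes "x \<in> mspace X" "y \<in> mspace X" "mdist X x y \<le> S"
  shows "reachable X S x y"
  unfolding reachable_def S_chain_def
  by (rule exI[of _ "[x, y]"]) (use assms in auto)

lemma reachable_refl:
  assumes "x \<in> mspace X"
  shows "reachable X S x x"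
  unfolding reachable_def S_chain_def
  by (rule exI[of _ "[x]"]) (use assms in auto)

lemma reachable_sym:
  assumes "reachable X S x y"
  shows "reachable X S y x"
proof -
  obtain xs where "S_chain X S xs" "hd xs = x" "last xs = y"
    using assms unfolding reachable_def by blast
  then have "S_chain X S (rev xs) \<and> hd (rev xs) = y \<and> last (rev xs) = x"
    by (auto simp: S_chain_def hd_rev last_rev mdist_commute)
  then show ?thesis unfolding reachable_def by blast
qed

text \<open>Concatenating the two chains repeats the junction \<open>y\<close>; the step from
  \<open>y\<close> to itself has length 0, which is where \<open>0 \<le> S\<close> enters.\<close>

lemma reachable_trans:
  assumes "0 \<le> S" "reachable X S x y" "reachable X S y z"
  shows "reachable X S x z"
proof -
  obtain xs where xs: "S_chain X S xs" "hd xs = x" "last xs = y"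
    using assms unfolding reachable_def by blast
  obtain ys where ys: "S_chain X S ys" "hd ys = y" "last ys = z"
    using assms unfolding reachable_def by blast
  have "mdist X y y = 0" using reachable_mspace[OF assms(2)] by simp
  then have "S_chain X S (xs @ ys) \<and> hd (xs @ ys) = x \<and> last (xs @ ys) = z"
    using xs ys assms(1) by (auto simp: S_chain_def successively_append_iff)
  then show ?thesis unfolding reachable_def by blast
qed

lemma reachable_mono:
  assumes "S \<le> T" "reachable X S x y"
  shows "reachable X T x y"
proof -
  obtain xs where xs: "S_chain X S xs" "hd xs = x" "last xs = y"
    using assms unfolding reachable_def by blast
  then have "S_chain X T xs"
    using assms(1) by (auto simp: S_chain_def elim!: successively_mono)
  with xs show ?thesis unfolding reachable_def by blast
qed

lemma Collect_reachable_eq_iff: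
  assumes "0 \<le> S" "x \<in> mspace X" "y \<in> mspace X"
  shows "Collect (reachable X S x) = Collect (reachable X S y) \<longleftrightarrow> reachable X S x y"
proof
  assume "Collect (reachable X S x) = Collect (reachable X S y)"
  then show "reachable X S x y" using reachable_refl[OF assms(3)] by blast
next
  assume xy: "reachable X S x y"
  show "Collect (reachable X S x) = Collect (reachable X S y)"
    using reachable_trans[OF assms(1) xy] reachable_trans[OF assms(1) reachable_sym[OF xy]] by auto
qed

lemma reachable_chain_elem:
  assumes "S_chain X S xs" "w \<in> set xs"
  shows "reachable X S (hd xs) w"
proof -
  obtain us vs where "xs = (us @ [w]) @ vs"
    using split_list[OF assms(2)] by auto
  moreover from this have "S_chain X S (us @ [w])"
    using assms(1) unfolding S_chain_def by (auto simp: successively_append_iff)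
  ultimately show ?thesis
    unfolding reachable_def by (metis append_is_Nil_conv hd_append2 last_snoc not_Cons_self2)
qed

text \<open>Connected: every point of a chain is reachable from its head, so a chain that starts in
  the class stays in it. Maximal: a connected superset contains \<open>x\<close>, hence all its
  points are joined to \<open>x\<close>.\<close>

lemma S_component_reachable:
  assumes "0 \<le> S" "x \<in> mspace X"
  shows "S_component X S (Collect (reachable X S x))"
proof -
  have "\<exists>xs. S_chain X S xs \<and> set xs \<subseteq> Collect (reachable X S x) \<and> hd xs = y \<and> last xs = z"
    if y: "reachable X S x y" and z: "reachable X S x z" for y z
  proof -
    have "reachable X S y z"
      using reachable_trans[OF assms(1) reachable_sym[OF y] z] .
    then obtain xs where xs: "S_chain X S xs" "hd xs = y" "last xs = z"
      unfolding reachable_def by blast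
    then have "set xs \<subseteq> Collect (reachable X S x)"
      using reachable_chain_elem[OF xs(1)] reachable_trans[OF assms(1) y] by auto
    with xs show ?thesis by blast
  qed
  then have "S_connected X S (Collect (reachable X S x))"
    unfolding S_connected_def by (auto dest: reachable_mspace(2))
  moreover have "C' = Collect (reachable X S x)"
    if C': "S_connected X S C'" "Collect (reachable X S x) \<subseteq> C'" for C'
  proof
    have "x \<in> C'" using C'(2) reachable_refl[OF assms(2)] by blast
    then show "C' \<subseteq> Collect (reachable X S x)"
      using C'(1) unfolding S_connected_def reachable_def by fast
  qed (rule C'(2))
  ultimately show ?thesis unfolding S_component_def by blast
qed

text \<open>The ball of radius \<open>S\<close> about any point meets a countable dense set, so
  every class is the class of a point of that set.\<close>

lemma countable_reachable_classes:
  assumes "separable_space (mtopology_of X)" "0 < S"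
  shows "countable ((\<lambda>x. Collect (reachable X S x)) ` mspace X)"
proof -
  interpret Metric_space "mspace X" "mdist X" by blast
  obtain Q where Q: "countable Q" "Q \<subseteq> mspace X" "mtopology closure_of Q = mspace X"
    using assms(1) unfolding separable_space_def by (auto simp: mtopology_of_def)
  have "\<exists>q\<in>Q. reachable X S x q" if "x \<in> mspace X" for x
  proof -
    have "x \<in> mtopology closure_of Q" using Q(3) that by simp
    then obtain q where "q \<in> Q" "q \<in> mball x S"
      using assms(2) unfolding metric_closure_of by blast
    then show ?thesis using that by (intro bexI[of _ q] reachable_step) auto
  qed
  then have "(\<lambda>x. Collect (reachable X S x)) ` mspace X \<subseteq> (\<lambda>x. Collect (reachable X S x)) ` Q"
    using Q(2) Collect_reachable_eq_iff[of S _ X] assms(2) by (smt (verit) image_iff subset_iff)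
  then show ?thesis using Q(1) by (meson countable_image countable_subset)
qed

section \<open>Embedding a space of uniform dimension zero\<close>

lemma tendsto_zero_right_obtain:
  fixes h :: "real \<Rightarrow> real"
  assumes "(h \<longlongrightarrow> 0) (at 0 within {0..})" "0 < e"
  obtains t where "0 < t" "\<And>s. 0 < s \<Longrightarrow> s < t \<Longrightarrow> \<bar>h s\<bar> < e"
proof -
  obtain t where "0 < t" "\<forall>s\<in>{0..}. s \<noteq> 0 \<and> dist s 0 < t \<longrightarrow> dist (h s) 0 < e"
    using tendstoD[OF assms] unfolding eventually_at by blast
  then show ?thesis by (intro that[of t]) (auto simp: dist_real_def)
qed

lemma countable_inj_into_infinite:
  fixes C :: "'a set" and A :: "'b set"
  assumes "countable C" "infinite A" "a \<in> A"
  obtains h where "inj_on h C" "h ` C \<subseteq> A" "c \<in> C \<Longrightarrow> h c = a"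
proof -
  obtain e :: "nat \<Rightarrow> 'b" where e: "inj e" "range e \<subseteq> A"
    using infinite_countable_subset[OF assms(2)] by blast
  define g where "g = e \<circ> to_nat_on C"
  have g: "inj_on g C" "g ` C \<subseteq> A"
    using e assms(1) unfolding g_def
    by (auto intro!: comp_inj_on inj_on_to_nat_on intro: inj_on_subset)
  \<comment> \<open>A swap of values: \<open>c\<close> receives \<open>a\<close>, and the point that
    \<open>g\<close> sent to \<open>a\<close>, if there is one, takes over \<open>g c\<close>. This
    keeps injectivity when \<open>c\<close> lies in \<open>C\<close>; otherwise \<open>g\<close>
    itself serves.\<close>
  define h where "h x = (if x = c then a else if g x = a then g c else g x)" for x
  have "inj_on h C" if "c \<in> C"
    using g(1) that unfolding h_def inj_on_def by metis
  moreover have "h ` C \<subseteq> A" if "c \<in> C"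
    using g(2) assms(3) that unfolding h_def by auto
  moreover have "h c = a" unfolding h_def by simp
  ultimately show ?thesis using that[of h] that[of g] g by (cases "c \<in> C") auto
qed

lemma dim_u_le_0_imp_embedding:
  fixes X :: "'a metric" and A :: "'b set" and s0 :: 'b
  assumes sep: "separable_space (mtopology_of X)" and A: "infinite A" "s0 \<in> A"
    and dim: "dim_u_le_0 X"
  shows "\<exists>f. bi_uniform_embedding X (L_omega A s0) f"
proof (cases "mspace X = {}")
  case True
  have "(\<lambda>t::real. t) ` {0..} \<subseteq> {0..} \<and> mono_on {0..} (\<lambda>t::real. t) \<and>
      ((\<lambda>t::real. t) \<longlongrightarrow> 0) (at 0 within {0..})"
    by (auto simp: mono_on_def tendsto_ident_at)
  then show ?thesis
    using True unfolding bi_uniform_embedding_def uniform_map_def by auto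
next
  case False
  then obtain p where p: "p \<in> mspace X" by blast
  obtain D :: "real \<Rightarrow> real" where D: "D ` {0..} \<subseteq> {0..}" "continuous_on {0..} D"
      "strict_mono_on {0..} D" "D 0 = 0"
      and comp: "\<And>S C. 0 < S \<Longrightarrow> S_component X S C \<Longrightarrow> D_bounded X (D S) C"
    using dim unfolding dim_u_le_0_def by blast
  define R where "R m = reachable X (3 powi (- m))" for m :: int
  have pos: "0 < (3::real) powi n" for n by simp
  have bound: "mdist X x y \<le> D (3 powi (- m))" if "R m x y" for m x y
    using comp[OF pos S_component_reachable[OF less_imp_le[OF pos]]] reachable_refl reachable_mspace
      that unfolding D_bounded_def R_def by (metis mem_Collect_eq)
  have "\<exists>h. inj_on h ((\<lambda>x. Collect (R m x)) ` mspace X) \<and>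
      h ` (\<lambda>x. Collect (R m x)) ` mspace X \<subseteq> A \<and> h (Collect (R m p)) = s0" for m
    unfolding R_def
    by (rule countable_inj_into_infinite[OF countable_reachable_classes[OF sep pos] A,
          of "- m" "Collect (reachable X (3 powi - m) p)"])
      (use p in blast)
  then obtain h where h: "\<And>m. inj_on (h m) ((\<lambda>x. Collect (R m x)) ` mspace X)"
      "\<And>m. h m ` (\<lambda>x. Collect (R m x)) ` mspace X \<subseteq> A" "\<And>m. h m (Collect (R m p)) = s0"
    by metis
  define f where "f x m = h m (Collect (R m x))" for x m
  have f_eq: "f x m = f y m \<longleftrightarrow> R m x y" if "x \<in> mspace X" "y \<in> mspace X" for x y m
    using inj_on_eq_iff[OF h(1)[of m], of "Collect (R m x)" "Collect (R m y)"] that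
      Collect_reachable_eq_iff[OF less_imp_le[OF pos] that]
    unfolding f_def R_def by simp
  have f_L: "f x \<in> L_omega_set A s0" if x: "x \<in> mspace X" for x
  proof -
    \<comment> \<open>At every index below \<open>-N\<close> the scale exceeds the distance from
      \<open>x\<close> to \<open>p\<close>, so a single step puts \<open>x\<close> into the class of
      \<open>p\<close>, which is coded by \<open>s0\<close>.\<close>
    obtain N :: nat where N: "mdist X x p < 3 ^ N"
      using real_arch_pow[of 3] by auto
    have "f x m = s0" if "m < - int N" for m
    proof -
      have "(3::real) ^ N \<le> 3 powi (- m)"
        using that power_int_increasing[of "int N" "- m" "3::real"] by simp
      then have "R m x p"
        unfolding R_def using N x p by (intro reachable_step) auto
      then show ?thesis using f_eq[OF x p] h(3) unfolding f_def by simp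
    qed
    moreover have "f x m \<in> A" for m using h(2) x unfolding f_def by blast
    ultimately show ?thesis unfolding L_omega_set_def by blast
  qed
  have inj: "inj_on f (mspace X)"
  proof (rule inj_onI, rule ccontr)
    fix x y assume xy: "x \<in> mspace X" "y \<in> mspace X" "f x = f y" "x \<noteq> y"
    then have d: "0 < mdist X x y" using mdist_nonneg[of X x y] mdist_zero[of x X y] by linarith
    \<comment> \<open>If \<open>f x = f y\<close>, the two points share a component at every scale
      \<open>3 powi (- n)\<close>, so their distance is at most \<open>D\<close> of that scale,
      which tends to 0.\<close>
    have D0: "(D \<longlongrightarrow> 0) (at 0 within {0..})"
      using D(2,4) unfolding continuous_on_def by force
    obtain e where e: "e > 0" "\<And>t. 0 < t \<Longrightarrow> t < e \<Longrightarrow> \<bar>D t\<bar> < mdist X x y"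
      using tendsto_zero_right_obtain[OF D0 d] by blast
    obtain n where n: "(1/3::real) ^ n < e"
      using real_arch_pow_inv[of e "1/3"] e(1) by auto
    have "(3::real) powi (- int n) = (1/3) ^ n" by (simp add: power_int_minus power_one_over inverse_eq_divide)
    then have "\<bar>D (3 powi (- int n))\<bar> < mdist X x y" using n by (intro e(2)) auto
    moreover have "R (int n) x y" using xy f_eq by metis
    ultimately show False using bound[of "int n" x y] by linarith
  qed
  have lipschitz: "mu (f x) (f y) \<le> mdist X x y" if xy: "x \<in> mspace X" "y \<in> mspace X" for x y
  proof (cases "f x = f y")
    case True
    then show ?thesis by (simp add: mu_def)
  next
    case False
    obtain m where m: "f x m \<noteq> f y m" "mu (f x) (f y) = 3 powi (- m)"
      using mu_index[OF f_L f_L False] xy by blast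
    \<comment> \<open>Points at distance at most \<open>3 powi (- m)\<close> are joined by one step
      at that scale, so their codes at index \<open>m\<close> would agree.\<close>
    have "\<not> mdist X x y \<le> 3 powi (- m)"
      using m(1) f_eq[OF xy] reachable_step[OF xy] unfolding R_def by blast
    then show ?thesis using m(2) by linarith
  qed
  have inverse: "mdist X x y \<le> D (3 * mu (f x) (f y))" if xy: "x \<in> mspace X" "y \<in> mspace X" for x y
  proof (cases "f x = f y")
    case True
    then have "x = y" using inj xy by (meson inj_onD)
    then have "mdist X x y = 0" using xy by simp
    then show ?thesis using D(4) True by (simp add: mu_def)
  next
    case False
    obtain m where m: "\<forall>n<m. f x n = f y n" "mu (f x) (f y) = 3 powi (- m)"
      using mu_index[OF f_L f_L False] xy by blast
    \<comment> \<open>The last index where agreement is certain is \<open>m - 1\<close>. Its scale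
      is three times as coarse as the distance of the images, whence the factor 3 in the modulus of
      the inverse.\<close>
    have "R (m - 1) x y" using m(1) f_eq[OF xy] by (metis zle_diff1_eq order_refl)
    then have "mdist X x y \<le> D (3 powi (1 - m))" using bound by fastforce
    also have "(3::real) powi (1 - m) = 3 * 3 powi (- m)"
      using power_int_add[of "3::real" 1 "- m"] by simp
    finally show ?thesis using m(2) by simp
  qed
  have "uniform_map X (L_omega A s0) f"
    unfolding uniform_map_def
    by (intro conjI exI[of _ "\<lambda>t. t"]) (use f_L lipschitz in \<open>auto simp: mono_on_def tendsto_ident_at\<close>)
  moreover have "uniform_map (submetric (L_omega A s0) (f ` mspace X)) X (inv_into (mspace X) f)"
    unfolding uniform_map_def
  proof (intro conjI exI[of _ "\<lambda>t. D (3 * t)"])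
    show "(\<lambda>t. D (3 * t)) ` {0..} \<subseteq> {0..}" using D(1) by (simp add: image_subset_iff)
    show "mono_on {0..} (\<lambda>t. D (3 * t))"
      using strict_mono_on_imp_mono_on[OF D(3)] by (auto simp: mono_on_def)
    have "continuous_on {0..} (\<lambda>t. D (3 * t))"
      by (rule continuous_on_compose2[OF D(2)]) (auto intro!: continuous_intros)
    then show "((\<lambda>t. D (3 * t)) \<longlongrightarrow> 0) (at 0 within {0..})"
      using D(4) unfolding continuous_on_def by force
  qed (use inj inverse in \<open>auto simp: inv_into_f_f\<close>)
  ultimately show ?thesis using inj unfolding bi_uniform_embedding_def by blast
qed

section \<open>Continuous majorants of monotone moduli\<close>

text \<open>Monotonicity places the mean over \<open>[S, 2 S]\<close> between \<open>g S\<close> and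
  \<open>g (2 * S)\<close>: the lower bound makes it a majorant, the upper one gives continuity at
  0. The added \<open>S\<close> supplies strictness and divergence.\<close>

lemma continuous_strict_mono_majorant:
  fixes g :: "real \<Rightarrow> real"
  assumes nonneg: "g ` {0..} \<subseteq> {0..}" and mono: "mono_on {0..} g"
    and lim: "(g \<longlongrightarrow> 0) (at 0 within {0..})"
  obtains D :: "real \<Rightarrow> real" where "D ` {0..} \<subseteq> {0..}" "continuous_on {0..} D"
    "strict_mono_on {0..} D" "D 0 = 0" "filterlim D at_top at_top" "\<And>S. 0 < S \<Longrightarrow> g S \<le> D S"
proof -
  have g_nn: "0 \<le> g t" if "0 \<le> t" for t using nonneg that by auto
  have g_mono: "g s \<le> g t" if "0 \<le> s" "s \<le> t" for s t using mono that by (auto simp: mono_on_def)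
  have g0: "g 0 = 0"
  proof (rule antisym)
    show "g 0 \<le> 0"
      by (rule tendsto_lowerbound[OF lim]) (auto simp: eventually_at_filter g_mono at_within_Ici_at_right)
  qed (simp add: g_nn)
  have int: "g integrable_on {a..b}" if "0 \<le> a" for a b
    using mono that by (intro integrable_on_mono_on) (auto simp: mono_on_def)
  have int1: "(\<lambda>u. g (S * u)) integrable_on {1..2}" if "0 \<le> S" for S
    using that by (intro integrable_on_mono_on) (auto simp: mono_on_def intro!: g_mono mult_left_mono)
  \<comment> \<open>The mean over \<open>[S, 2 S]\<close> rescaled to a fixed interval: monotonicity
    in \<open>S\<close> becomes pointwise, and \<open>S = 0\<close> needs no division.\<close>
  define I where "I S = integral {1..2} (\<lambda>u. g (S * u))" for S
  define D where "D S = S + I S" for S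
  have I_mono: "I s \<le> I t" if "0 \<le> s" "s \<le> t" for s t
    unfolding I_def using that
    by (intro integral_le int1) (auto intro!: g_mono mult_right_mono)
  have I_ge: "g S \<le> I S" if "0 \<le> S" for S
  proof -
    have "integral {1..2} (\<lambda>u::real. g S) \<le> I S"
      unfolding I_def using that
      by (intro integral_le int1) (auto intro!: g_mono simp: mult_le_cancel_left1)
    then show ?thesis by simp
  qed
  have I_le: "I S \<le> g (2 * S)" if "0 \<le> S" for S
  proof -
    have "I S \<le> integral {1..2} (\<lambda>u::real. g (2 * S))"
      unfolding I_def using that
      by (intro integral_le int1) (auto intro!: g_mono simp: mult.commute[of 2] mult_left_mono)
    then show ?thesis by simp
  qed
  have I_nn: "0 \<le> I S" if "0 \<le> S" for S
    using I_ge[OF that] g_nn[OF that] by linarith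
  have I0: "I 0 = 0" using I_ge[of 0] I_le[of 0] g0 by simp
  \<comment> \<open>Undoing the rescaling expresses \<open>I\<close> through the indefinite integral
    of \<open>g\<close>, which is continuous even where \<open>g\<close> jumps.\<close>
  have I_eq: "I S = (integral {0..2 * S} g - integral {0..S} g) / S" if "0 < S" for S
  proof -
    have "integral {1..2} (\<lambda>u. g (S * u)) = integral {S..2 * S} g / S"
      using integral_stretch_real[of S S "2 * S" g] that by (simp add: field_simps)
    moreover have "integral {0..S} g + integral {S..2 * S} g = integral {0..2 * S} g"
      using that by (intro Henstock_Kurzweil_Integration.integral_combine int) auto
    ultimately show ?thesis unfolding I_def by simp
  qed
  have cont_G: "continuous_on {0..b} (\<lambda>x. integral {0..x} g)" for b
    by (intro indefinite_integral_continuous_1 int) simp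
  have "continuous (at S within {0..}) I" if "0 \<le> S" for S
  proof (cases "S = 0")
    case True
    have "((\<lambda>t. g (2 * t)) \<longlongrightarrow> 0) (at 0 within {0..})"
    proof (rule filterlim_compose[OF lim])
      show "filterlim (\<lambda>t::real. 2 * t) (at 0 within {0..}) (at 0 within {0..})"
        by (auto simp: filterlim_at eventually_at_filter intro!: tendsto_eq_intros)
    qed
    then have "(I \<longlongrightarrow> 0) (at 0 within {0..})"
      by (rule tendsto_sandwich[OF _ _ tendsto_const, rotated -1])
        (auto simp: eventually_at_filter I_le I_nn)
    then show ?thesis unfolding True continuous_within I0 .
  next
    case False
    then have S: "0 < S" using that by simp
    \<comment> \<open>On this open neighbourhood of \<open>S\<close> the upper limits
      \<open>2 * x\<close> and \<open>x\<close> stay below \<open>4 * S\<close> and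
      \<open>2 * S\<close>.\<close>
    have "continuous_on {0<..<2 * S} (\<lambda>x. (integral {0..2 * x} g - integral {0..x} g) / x)"
      by (intro continuous_intros continuous_on_compose2[OF cont_G[of "4 * S"]]
          continuous_on_subset[OF cont_G[of "2 * S"]]) auto
    then have "continuous_on {0<..<2 * S} I"
      by (rule continuous_on_eq) (simp add: I_eq)
    then have "isCont I S"
      using S by (simp add: continuous_on_eq_continuous_at)
    then show ?thesis by (rule continuous_at_imp_continuous_at_within)
  qed
  then have cont: "continuous_on {0..} D"
    unfolding D_def by (intro continuous_intros) (auto simp: continuous_on_eq_continuous_within)
  have strict: "strict_mono_on {0..} D"
    unfolding D_def by (auto simp: strict_mono_on_def intro!: add_less_le_mono I_mono)
  have at_top: "filterlim D at_top at_top"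
  proof (rule filterlim_at_top_mono[OF filterlim_ident])
    show "\<forall>\<^sub>F S in at_top. S \<le> D S"
      using eventually_ge_at_top[of 0] by eventually_elim (simp add: D_def I_nn)
  qed
  have ge: "g S \<le> D S" if "0 < S" for S
    using I_ge[of S] that by (simp add: D_def)
  show ?thesis
  proof (rule that[OF _ cont strict _ at_top ge])
    show "D ` {0..} \<subseteq> {0..}" by (auto simp: D_def I_nn)
    show "D 0 = 0" by (simp add: D_def I0)
  qed
qed

section \<open>Subspaces of the space of sequences\<close>

text \<open>Under the ultrametric inequality the steps of a chain do not add up: the distance of its
  ends is bounded by the largest step, whatever its length.\<close>

lemma mu_chain_le:
  assumes "xs \<noteq> []" "f ` set xs \<subseteq> L_omega_set A s0" "0 \<le> r"
    and "successively (\<lambda>x y. mu (f x) (f y) \<le> r) xs"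
  shows "mu (f (hd xs)) (f (last xs)) \<le> r"
  using assms
proof (induction xs rule: induct_list012)
  case (3 x y zs)
  then have "mu (f y) (f (last (y # zs))) \<le> r" by simp
  moreover have "f (last (y # zs)) \<in> L_omega_set A s0"
    using "3.prems"(2) last_in_set[of "y # zs"] by auto
  ultimately show ?case
    using "3.prems" mu_ultrametric[of "f x" A s0 "f y" "f (last (y # zs))"] by auto
qed (auto simp: mu_def)

lemma embedding_imp_dim_u_le_0:
  assumes "bi_uniform_embedding X (L_omega A s0) f"
  shows "dim_u_le_0 X"
proof -
  have inj: "inj_on f (mspace X)" and f: "uniform_map X (L_omega A s0) f"
    and f': "uniform_map (submetric (L_omega A s0) (f ` mspace X)) X (inv_into (mspace X) f)"
    using assms unfolding bi_uniform_embedding_def by auto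
  obtain \<delta> :: "real \<Rightarrow> real" where \<delta>: "\<delta> ` {0..} \<subseteq> {0..}" "mono_on {0..} \<delta>"
      "(\<delta> \<longlongrightarrow> 0) (at 0 within {0..})"
      "\<And>x y. x \<in> mspace X \<Longrightarrow> y \<in> mspace X \<Longrightarrow> mu (f x) (f y) \<le> \<delta> (mdist X x y)"
    and f_L: "f ` mspace X \<subseteq> L_omega_set A s0"
    using f unfolding uniform_map_def by auto
  obtain \<epsilon> :: "real \<Rightarrow> real" where \<epsilon>: "\<epsilon> ` {0..} \<subseteq> {0..}" "mono_on {0..} \<epsilon>"
      "(\<epsilon> \<longlongrightarrow> 0) (at 0 within {0..})"
      and \<epsilon>_f: "\<forall>u\<in>f ` mspace X. \<forall>v\<in>f ` mspace X.
        mdist X (inv_into (mspace X) f u) (inv_into (mspace X) f v) \<le> \<epsilon> (mu u v)"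
    using f' f_L unfolding uniform_map_def by (auto simp: Int_absorb2)
  have \<epsilon>_le: "mdist X x y \<le> \<epsilon> (mu (f x) (f y))" if "x \<in> mspace X" "y \<in> mspace X" for x y
    using \<epsilon>_f that inj by (metis imageI inv_into_f_f)
  define g where "g = \<epsilon> \<circ> \<delta>"
  have \<delta>_nn: "0 \<le> \<delta> t" if "0 \<le> t" for t using \<delta>(1) that by auto
  have "g ` {0..} \<subseteq> {0..}" using \<delta>(1) \<epsilon>(1) unfolding g_def by (simp add: image_subset_iff)
  moreover have "mono_on {0..} g"
    using \<delta>(2) \<epsilon>(2) \<delta>_nn unfolding g_def mono_on_def by simp
  moreover have "(g \<longlongrightarrow> 0) (at 0 within {0..})"
  proof (rule tendstoI)
    fix e :: real assume "0 < e"
    then obtain t where t: "0 < t" "\<And>s. 0 < s \<Longrightarrow> s < t \<Longrightarrow> \<bar>\<epsilon> s\<bar> < e"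
      using tendsto_zero_right_obtain[OF \<epsilon>(3)] by blast
    \<comment> \<open>The limit of \<open>\<epsilon>\<close> at 0 says nothing about
      \<open>\<epsilon> 0\<close>, yet \<open>\<delta>\<close> may take the value 0. Monotonicity
      closes the gap by comparison with the positive point \<open>t / 2\<close>.\<close>
    have small: "\<epsilon> s < e" if "0 \<le> s" "s < t / 2" for s
    proof -
      have "\<epsilon> s \<le> \<epsilon> (t / 2)" using \<epsilon>(2) that unfolding mono_on_def by simp
      then show ?thesis using t(2)[of "t / 2"] t(1) by simp
    qed
    have "\<forall>\<^sub>F S in at 0 within {0..}. dist (\<delta> S) 0 < t / 2"
      using t(1) by (intro tendstoD[OF \<delta>(3)]) simp
    moreover have "\<forall>\<^sub>F S in at 0 within {0..}. 0 \<le> (S::real)"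
      by (auto simp: eventually_at_filter)
    ultimately show "\<forall>\<^sub>F S in at 0 within {0..}. dist (g S) 0 < e"
    proof eventually_elim
      case (elim S)
      have "0 \<le> g S" using \<epsilon>(1) \<delta>_nn[OF elim(2)] unfolding g_def by auto
      moreover have "g S < e"
        unfolding g_def using small \<delta>_nn[OF elim(2)] elim(1) by (simp add: dist_real_def)
      ultimately show ?case by (simp add: dist_real_def)
    qed
  qed
  ultimately obtain D where D: "D ` {0..} \<subseteq> {0..}" "continuous_on {0..} D"
      "strict_mono_on {0..} D" "D 0 = 0" "filterlim D at_top at_top" "\<And>S. 0 < S \<Longrightarrow> g S \<le> D S"
    by (rule continuous_strict_mono_majorant) blast
  have "D_bounded X (D S) C" if S: "0 < S" and C: "S_component X S C" for S C
  proof -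
    have conn: "S_connected X S C" using C unfolding S_component_def by blast
    have "mdist X x y \<le> D S" if xy: "x \<in> C" "y \<in> C" for x y
    proof -
      obtain xs where xs: "S_chain X S xs" "hd xs = x" "last xs = y"
        using conn xy unfolding S_connected_def by blast
      \<comment> \<open>Monotonicity of \<open>\<delta>\<close> replaces the varying step lengths by
        \<open>S\<close>, so one bound serves for all steps of the chain.\<close>
      have "successively (\<lambda>x y. mu (f x) (f y) \<le> \<delta> S) xs"
      proof (rule successively_mono)
        show "successively (\<lambda>x y. mdist X x y \<le> S) xs" using xs(1) unfolding S_chain_def by blast
        fix u v assume "u \<in> set xs" "v \<in> set xs" and uv: "mdist X u v \<le> S"
        then have "mu (f u) (f v) \<le> \<delta> (mdist X u v)"
          using xs(1) \<delta>(4) unfolding S_chain_def by blast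
        also have "\<dots> \<le> \<delta> S" using \<delta>(2) uv S unfolding mono_on_def by simp
        finally show "mu (f u) (f v) \<le> \<delta> S" .
      qed
      moreover have "xs \<noteq> []" "f ` set xs \<subseteq> L_omega_set A s0"
        using xs(1) f_L unfolding S_chain_def by blast+
      ultimately have "mu (f x) (f y) \<le> \<delta> S"
        using mu_chain_le[of xs f A s0 "\<delta> S"] \<delta>_nn S xs by simp
      moreover have "x \<in> mspace X" "y \<in> mspace X"
        using conn xy unfolding S_connected_def by blast+
      ultimately have "mdist X x y \<le> g S"
        using \<epsilon>_le[of x y] \<epsilon>(2) mu_nonneg[of "f x" "f y"] \<delta>_nn[of S] S
        unfolding g_def mono_on_def by (smt (verit) atLeast_iff comp_apply)
      then show ?thesis using D(6)[OF S] by linarith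
    qed
    then show ?thesis using conn unfolding D_bounded_def S_connected_def by blast
  qed
  then show ?thesis unfolding dim_u_le_0_def using D(1-5) by blast
qed

theorem corollary4p4:
  fixes X :: "'a metric" and A :: "'b set" and s0 :: 'b
  assumes "separable_space (mtopology_of X)"
    and "countable A" and "infinite A" and "s0 \<in> A"
  shows "dim_u_le_0 X \<longleftrightarrow> (\<exists>f. bi_uniform_embedding X (L_omega A s0) f)"
proof
  assume "dim_u_le_0 X"
  then show "\<exists>f. bi_uniform_embedding X (L_omega A s0) f"
    by (rule dim_u_le_0_imp_embedding[OF assms(1,3,4)])
next
  assume "\<exists>f. bi_uniform_embedding X (L_omega A s0) f"
  then obtain f where "bi_uniform_embedding X (L_omega A s0) f" ..
  then show "dim_u_le_0 X" by (rule embedding_imp_dim_u_le_0)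
qed

end
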